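(* Let $u^\dagger$ be a $J$-minimizing solution of $Ku=g$ that satisfies the source condition $K^*p^\dagger\in\partial J(u^\dagger)$ with source element $p^\dagger\in H_2$, and let $\Gamma$ be Morozov's discrepancy principle with parameter $\rho>1$. Then, for every $\delta>0$ and every $g^\delta\in H_2$ with $\|g^\delta-g\|\le\delta$, $$\delta\, t_{\Gamma(\delta,g^\delta)}\le\frac{\|p^\dagger-p_0\|}{\sqrt{\rho-1}}+\delta\bar\tau .$$ In particular, for all $\delta_k>0$ with $\delta_k\to0$ and $g_k\in H_2$ with $\|g_k-g\|\le\delta_k$, there exists $C\in\mathbb{R}$ such that $\delta_k t_{\Gamma(\delta_k,g_k)}\le C$ for all $k$.
   Context: $H_1,H_2$ are separable (real) Hilbert spaces, $K:H_1\to H_2$ is linear and bounded with adjoint $K^*$, and $J:H_1\to\mathbb{R}\cup\{\infty\}$ is convex, lower semicontinuous and proper with domain $D(J)=\{u: J(u)<\infty\}$. It is assumed that for every $c\in\mathbb{R}$ every sequence in $\{u\in H_1:\|Ku\|^2+J(u)\le c\}$ has a weakly convergent subsequence in $H_1$. The element $g\in H_2$ is attainable, i.e. $Ku=g$ for some $u\in D(J)$. A $J$-minimizing solution of $Ku=g$ is a minimizer of $J(u)$ subject to $Ku=g$. Augmented Lagrangian method: $\{\tau_n\}_{n\ge1}$ is a fixed sequence of positive numbers, $t_n:=\sum_{k=1}^n\tau_k$, with $t_n\to+\infty$ and $\bar\tau:=\sup_k\tau_k<\infty$. Given data $g^\delta$ and a fixed starting element $p_0^\delta=p_0\in H_2$,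 for $n=1,2,\dots$ $$u_n^\delta\in\operatorname{argmin}_{u\in H_1}\Big(\tfrac{\tau_n}{2}\|Ku-g^\delta\|^2+J(u)-\langle p_{n-1}^\delta,Ku-g^\delta\rangle\Big),\qquad p_n^\delta=p_{n-1}^\delta+\tau_n(g^\delta-Ku_n^\delta).$$ Morozov's discrepancy principle with $\rho>1$ is the stopping rule $\Gamma(\delta,g^\delta):=\min\{n\in\mathbb{N}, n\ge1:\ \|Ku_n^\delta-g^\delta\|<\rho\delta\}$ (this minimum exists). *)

theory Defs
  imports "HOL-Analysis.Analysis"
begin

subsection \<open>Extended-real-valued functionals\<close>

definition eff_domain :: "('a \<Rightarrow> ereal) \<Rightarrow> 'a set" where
  "eff_domain J = {u. J u < \<infinity>}"

text \<open>Functionals with values in the reals extended by \<open>\<infinity>\<close> only are rendered as \<open>ereal\<close>-valued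
  ones; the exclusion of \<open>-\<infinity>\<close> is the second conjunct.\<close>

definition proper_fun :: "('a \<Rightarrow> ereal) \<Rightarrow> bool" where
  "proper_fun J \<longleftrightarrow> eff_domain J \<noteq> {} \<and> (\<forall>u. J u \<noteq> -\<infinity>)"

definition convex_fun :: "('a::real_vector \<Rightarrow> ereal) \<Rightarrow> bool" where
  "convex_fun J \<longleftrightarrow> (\<forall>u v. \<forall>s\<in>{0..1}.
     J ((1 - s) *\<^sub>R u + s *\<^sub>R v) \<le> ereal (1 - s) * J u + ereal s * J v)"

definition lsc_fun :: "('a::topological_space \<Rightarrow> ereal) \<Rightarrow> bool" where
  "lsc_fun J \<longleftrightarrow> (\<forall>u. J u \<le> Liminf (at u) J)"

definition subdifferential :: "('a::real_inner \<Rightarrow> ereal) \<Rightarrow> 'a \<Rightarrow> 'a set" where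
  "subdifferential J u =
     {\<xi>. u \<in> eff_domain J \<and> (\<forall>v. J u + ereal (\<xi> \<bullet> (v - u)) \<le> J v)}"

definition weakly_converges :: "(nat \<Rightarrow> 'a::real_normed_vector) \<Rightarrow> 'a \<Rightarrow> bool" where
  "weakly_converges x l \<longleftrightarrow>
     (\<forall>f :: 'a \<Rightarrow> real. bounded_linear f \<longrightarrow> (\<lambda>n. f (x n)) \<longlonglongrightarrow> f l)"

definition weakly_seq_precompact :: "'a::real_normed_vector set \<Rightarrow> bool" where
  "weakly_seq_precompact S \<longleftrightarrow>
     (\<forall>x :: nat \<Rightarrow> 'a. (\<forall>n. x n \<in> S) \<longrightarrow>
        (\<exists>l r. strict_mono r \<and> weakly_converges (x \<circ> r) l))"

definition J_minimizing_solution ::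
  "('a \<Rightarrow> 'b) \<Rightarrow> ('a \<Rightarrow> ereal) \<Rightarrow> 'b \<Rightarrow> 'a \<Rightarrow> bool" where
  "J_minimizing_solution K J g u \<longleftrightarrow> is_arg_min J (\<lambda>v. K v = g) u"

subsection \<open>Augmented Lagrangian method\<close>

definition step_sum :: "(nat \<Rightarrow> real) \<Rightarrow> nat \<Rightarrow> real" where
  "step_sum \<tau> n = (\<Sum>k=1..n. \<tau> k)"

text \<open>The minimizers need not be unique, so the iterates form a relation: every admissible choice of
  minimizers is covered. Primal iterates start at index 1 (the value \<open>u 0\<close> is irrelevant), dual
  iterates at index 0.\<close>

definition alm_iterates ::
  "('a \<Rightarrow> 'b::real_inner) \<Rightarrow> ('a \<Rightarrow> ereal) \<Rightarrow> (nat \<Rightarrow> real) \<Rightarrow> 'b \<Rightarrow> 'b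
     \<Rightarrow> (nat \<Rightarrow> 'a) \<Rightarrow> (nat \<Rightarrow> 'b) \<Rightarrow> bool" where
  "alm_iterates K J \<tau> p\<^sub>0 gd u p \<longleftrightarrow>
     p 0 = p\<^sub>0 \<and>
     (\<forall>n\<ge>1.
        is_arg_min
          (\<lambda>v. ereal (\<tau> n / 2 * (norm (K v - gd))\<^sup>2) + J v - ereal (p (n - 1) \<bullet> (K v - gd)))
          (\<lambda>v. True) (u n) \<and>
        p n = p (n - 1) + \<tau> n *\<^sub>R (gd - K (u n)))"

definition morozov_index ::
  "('a \<Rightarrow> 'b::real_normed_vector) \<Rightarrow> real \<Rightarrow> real \<Rightarrow> 'b \<Rightarrow> (nat \<Rightarrow> 'a) \<Rightarrow> nat" where
  "morozov_index K \<rho> \<delta> gd u = (LEAST n. n \<ge> 1 \<and> norm (K (u n) - gd) < \<rho> * \<delta>)"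

end

theory Submission
  imports Defs
begin

text \<open>The augmented Lagrangian method is the proximal point method for the dual functional
  \<open>G(q) = J\<^sup>*(K\<^sup>* q) - \<langle>q, g\<^sup>\<delta>\<rangle>\<close>, with subgradient \<open>-r\<^sub>n = K u\<^sub>n - g\<^sup>\<delta>\<close> at \<open>p\<^sub>n\<close>.
  Gueler's estimate for that method reads
  \<open>2 t\<^sub>n (G(p\<^sub>n) - G(p\<^sup>\<dagger>)) + \<parallel>p\<^sub>n - p\<^sup>\<dagger>\<parallel>\<^sup>2 + t\<^sub>n\<^sup>2 \<parallel>r\<^sub>n\<parallel>\<^sup>2 \<le> \<parallel>p\<^sub>0 - p\<^sup>\<dagger>\<parallel>\<^sup>2\<close>.
  Since the source condition gives \<open>G(p\<^sub>n) - G(p\<^sup>\<dagger>) \<ge> -\<delta> \<parallel>p\<^sub>n - p\<^sup>\<dagger>\<parallel>\<close>, completing the square leaves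
  \<open>t\<^sub>n\<^sup>2 (\<parallel>r\<^sub>n\<parallel>\<^sup>2 - \<delta>\<^sup>2) \<le> \<parallel>p\<^sub>0 - p\<^sup>\<dagger>\<parallel>\<^sup>2\<close>. This shows that the stopping index exists, and evaluated one step
  before stopping, where \<open>\<parallel>r\<^sub>n\<parallel> \<ge> \<rho>\<delta>\<close>, it gives the claim even with \<open>sqrt (\<rho>\<^sup>2 - 1)\<close> in place
  of \<open>sqrt (\<rho> - 1)\<close>.\<close>

section \<open>Existence of the adjoint\<close>

text \<open>The representer of \<open>f\<close> is the minimizer of \<open>\<parallel>x\<parallel>\<^sup>2 - 2 f(x)\<close>; minimizing sequences are Cauchy by
  the parallelogram law.\<close>

lemma riesz_representation:
  fixes f :: "'a::{real_inner, complete_space} \<Rightarrow> real"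
  assumes "bounded_linear f"
  obtains x where "\<And>y. f y = x \<bullet> y"
proof -
  interpret f: bounded_linear f by fact
  define F where "F x = (norm x)\<^sup>2 - 2 * f x" for x
  obtain B where B: "\<And>x. norm (f x) \<le> norm x * B"
    using f.bounded by blast
  have "F x \<ge> - B\<^sup>2" for x
  proof -
    have "f x \<le> norm x * B" using B[of x] by simp
    moreover have "0 \<le> (norm x - B)\<^sup>2" by simp
    ultimately show ?thesis by (simp add: F_def power2_eq_square algebra_simps)
  qed
  then have bdd: "bdd_below (range F)" by (intro bdd_belowI2)
  define m where "m = Inf (range F)"
  have m_le: "m \<le> F x" for x
    unfolding m_def using bdd by (auto intro: cInf_lower)
  have "\<exists>x. F x < m + inverse (real (Suc n))" for n
    using cInf_lessD[of "range F" "m + inverse (real (Suc n))"] by (auto simp: m_def)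
  then obtain X where X: "\<And>n. F (X n) < m + inverse (real (Suc n))" by metis
  have para: "(norm (x - y))\<^sup>2 = 2 * F x + 2 * F y - 4 * F ((1/2) *\<^sub>R (x + y))" for x y
    unfolding F_def power2_norm_eq_inner
    by (simp add: f.add f.scaleR inner_simps inner_commute algebra_simps)
  have "Cauchy X"
  proof (rule CauchyI)
    fix e :: real assume e: "e > 0"
    obtain N where N: "inverse (real (Suc N)) < e\<^sup>2 / 4"
      using reals_Archimedean[of "e\<^sup>2 / 4"] e by auto
    have "norm (X i - X j) < e" if "i \<ge> N" "j \<ge> N" for i j
    proof -
      have "inverse (real (Suc i)) \<le> inverse (real (Suc N))"
        "inverse (real (Suc j)) \<le> inverse (real (Suc N))"
        using that by auto
      then have "(norm (X i - X j))\<^sup>2 < e\<^sup>2"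
        using para[of "X i" "X j"] X[of i] X[of j] m_le[of "(1/2) *\<^sub>R (X i + X j)"] N by linarith
      then show ?thesis using e by (simp add: power2_less_imp_less)
    qed
    then show "\<exists>M. \<forall>i\<ge>M. \<forall>j\<ge>M. norm (X i - X j) < e" by blast
  qed
  then obtain x where x: "X \<longlonglongrightarrow> x"
    using Cauchy_convergent convergent_def by blast
  have "(\<lambda>n. F (X n)) \<longlonglongrightarrow> F x"
    unfolding F_def by (intro tendsto_intros x f.tendsto)
  moreover have "(\<lambda>n. m + inverse (real (Suc n))) \<longlonglongrightarrow> m + 0"
    by (intro tendsto_intros LIMSEQ_inverse_real_of_nat)
  ultimately have min: "F x \<le> m"
    using X by (intro LIMSEQ_le[of _ "F x" _ m]) (auto intro!: less_imp_le)
  have "f y = x \<bullet> y" for y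
  proof (cases "y = 0")
    case False
    define c where "c = x \<bullet> y - f y"
    \<comment> \<open>This \<open>t\<close> minimizes the quadratic
      \<open>t\<^sup>2 * (norm y)\<^sup>2 + 2 * t * c\<close>, whose minimum is negative unless
      \<open>c = 0\<close>.\<close>
    define t where "t = - c / (norm y)\<^sup>2"
    have "F x \<le> F (x + t *\<^sub>R y)" using min m_le order_trans by blast
    then have "0 \<le> t\<^sup>2 * (norm y)\<^sup>2 + 2 * t * c"
      unfolding F_def c_def power2_norm_eq_inner
      by (simp add: f.add f.scaleR inner_simps inner_commute algebra_simps power2_eq_square[of t])
    also have "\<dots> = - (c\<^sup>2 / (norm y)\<^sup>2)"
      using False by (simp add: t_def field_simps power2_eq_square)
    finally have "c\<^sup>2 / (norm y)\<^sup>2 \<le> 0" by simp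
    then have "c = 0" using False by (simp add: divide_le_0_iff)
    then show ?thesis by (simp add: c_def)
  qed (simp add: f.zero)
  then show thesis using that by blast
qed

text \<open>\<open>adjoint\<close> is a choice term, so its identity is available only once some
  adjoint exists. Riesz representation of each functional \<open>q \<bullet> K x\<close> supplies
  one.\<close>

lemma adjoint_inner:
  fixes K :: "'a::{real_inner, complete_space} \<Rightarrow> 'b::real_inner"
  assumes "bounded_linear K"
  shows "adjoint K q \<bullet> x = q \<bullet> K x"
proof -
  have "\<exists>w. \<forall>x. q \<bullet> K x = w \<bullet> x" for q
    using riesz_representation[OF bounded_linear_compose[OF bounded_linear_inner_right assms]] by metis
  then obtain A where "\<And>q x. q \<bullet> K x = A q \<bullet> x" by metis
  then have "\<exists>A. \<forall>x q. K x \<bullet> q = x \<bullet> A q" by (metis inner_commute)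
  then have "\<forall>x q. K x \<bullet> q = x \<bullet> adjoint K q"
    unfolding adjoint_def by (rule someI_ex)
  then show ?thesis by (metis inner_commute)
qed

section \<open>Dual estimates for the augmented Lagrangian iterates\<close>

lemma proper_fun_eq_ereal:
  assumes "proper_fun J" "v \<in> eff_domain J"
  shows "J v = ereal (real_of_ereal (J v))"
  using assms by (cases "J v") (auto simp: proper_fun_def eff_domain_def)

text \<open>First-order optimality: the adjoint applied to the updated multiplier is a subgradient
  of \<open>J\<close> at \<open>u\<close>. Comparing \<open>u\<close> with points of a segment
  replaces a sum rule for subdifferentials.\<close>

lemma alm_step_optimality:
  fixes K :: "'a::real_inner \<Rightarrow> 'b::real_inner"
  assumes K: "linear K" and convex: "convex_fun J" and proper: "proper_fun J"
    and min: "is_arg_min (\<lambda>v. ereal (a / 2 * (norm (K v - gd))\<^sup>2) + J v - ereal (q \<bullet> (K v - gd)))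
          (\<lambda>v. True) u"
  shows "u \<in> eff_domain J"
    and "v \<in> eff_domain J \<Longrightarrow>
      real_of_ereal (J u) + (q + a *\<^sub>R (gd - K u)) \<bullet> (K v - K u) \<le> real_of_ereal (J v)"
proof -
  interpret K: linear K by fact
  define f where "f v = ereal (a / 2 * (norm (K v - gd))\<^sup>2) + J v - ereal (q \<bullet> (K v - gd))" for v
  have le: "f u \<le> f v" for v
    using min by (auto simp: is_arg_min_def f_def not_less)
  obtain w where w: "w \<in> eff_domain J" using proper by (auto simp: proper_fun_def)
  show u: "u \<in> eff_domain J"
  proof (rule ccontr)
    assume "u \<notin> eff_domain J"
    then have "f u = \<infinity>" by (simp add: eff_domain_def f_def)
    moreover have "f w < \<infinity>" using proper_fun_eq_ereal[OF proper w]
      by (cases "J w") (auto simp: f_def)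
    ultimately show False using le[of w] by simp
  qed
  assume v: "v \<in> eff_domain J"
  obtain x where x: "J u = ereal x" using proper_fun_eq_ereal[OF proper u] by blast
  obtain y where y: "J v = ereal y" using proper_fun_eq_ereal[OF proper v] by blast
  define d where "d = K v - K u"
  \<comment> \<open>Moving a fraction \<open>s\<close> towards \<open>v\<close> changes the penalty
    linearly up to a remainder of order \<open>s\<^sup>2\<close>. After division by \<open>s\<close>
    this remainder still vanishes as \<open>s\<close> tends to 0.\<close>
  have s: "x + (q + a *\<^sub>R (gd - K u)) \<bullet> d - y \<le> s * (a / 2 * (norm d)\<^sup>2)" if "0 < s" "s \<le> 1" for s
  proof -
    define z where "z = (1 - s) *\<^sub>R u + s *\<^sub>R v"
    have Jz: "J z \<le> ereal ((1 - s) * x + s * y)"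
      using convex that x y unfolding convex_fun_def z_def
      by (metis atLeastAtMost_iff less_eq_real_def plus_ereal.simps(1) times_ereal.simps(1))
    then have "z \<in> eff_domain J" by (auto simp: eff_domain_def intro: le_less_trans)
    then obtain r where r: "J z = ereal r" using proper_fun_eq_ereal[OF proper] by blast
    have Kz: "K z - gd = (K u - gd) + s *\<^sub>R d"
      unfolding z_def d_def K.add K.scaleR by (simp add: algebra_simps)
    have normz: "(norm (K z - gd))\<^sup>2
        = (norm (K u - gd))\<^sup>2 + 2 * s * ((K u - gd) \<bullet> d) + s\<^sup>2 * (norm d)\<^sup>2"
      unfolding Kz power2_norm_eq_inner
      by (simp add: inner_add_left inner_add_right inner_commute power2_eq_square)
    have innerz: "q \<bullet> (K z - gd) = q \<bullet> (K u - gd) + s * (q \<bullet> d)"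
      unfolding Kz by (simp add: inner_add_right)
    have "a / 2 * (norm (K u - gd))\<^sup>2 + x - q \<bullet> (K u - gd)
        \<le> a / 2 * (norm (K z - gd))\<^sup>2 + r - q \<bullet> (K z - gd)"
      using le[of z] by (simp add: f_def x r)
    moreover have "r \<le> (1 - s) * x + s * y" using Jz r by simp
    ultimately have "s * (x + q \<bullet> d - a * ((K u - gd) \<bullet> d) - y) \<le> s * (s * (a / 2 * (norm d)\<^sup>2))"
      unfolding normz innerz by (simp add: algebra_simps power2_eq_square[of s])
    then have "x + q \<bullet> d - a * ((K u - gd) \<bullet> d) - y \<le> s * (a / 2 * (norm d)\<^sup>2)"
      using that by simp
    then show ?thesis by (simp add: inner_diff_left inner_add_left algebra_simps)
  qed
  have "((\<lambda>s. s * (a / 2 * (norm d)\<^sup>2)) \<longlongrightarrow> 0 * (a / 2 * (norm d)\<^sup>2)) (at_right 0)"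
    by (intro tendsto_intros)
  moreover have "\<forall>\<^sub>F s in at_right (0::real).
      x + (q + a *\<^sub>R (gd - K u)) \<bullet> d - y \<le> s * (a / 2 * (norm d)\<^sup>2)"
    by (rule eventually_at_rightI[of 0 1]) (use s in \<open>simp_all only: greaterThanLessThan_iff less_imp_le zero_less_one\<close>)
  ultimately have "x + (q + a *\<^sub>R (gd - K u)) \<bullet> d - y \<le> 0"
    using tendsto_lowerbound by fastforce
  then show "real_of_ereal (J u) + (q + a *\<^sub>R (gd - K u)) \<bullet> (K v - K u) \<le> real_of_ereal (J v)"
    by (simp add: x y d_def)
qed

lemma step_sum_Suc: "step_sum \<tau> (Suc n) = step_sum \<tau> n + \<tau> (Suc n)"
  by (simp add: step_sum_def)

lemma step_sum_nonneg:
  assumes "\<And>n. n \<ge> 1 \<Longrightarrow> \<tau> n > 0"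
  shows "step_sum \<tau> n \<ge> 0"
  unfolding step_sum_def by (intro sum_nonneg less_imp_le[OF assms]) auto

text \<open>Here \<open>q\<close> is the source element, \<open>w\<close> the exact solution and \<open>j\<close> the real-valued restriction of \<open>J\<close>
  to its domain, so that \<open>G n = G(p\<^sub>n)\<close> and \<open>Gq = G(q)\<close>.\<close>

lemma dual_proximal_estimate:
  fixes K :: "'a \<Rightarrow> 'b::real_inner" and j :: "'a \<Rightarrow> real"
  assumes pos: "\<And>n. n \<ge> 1 \<Longrightarrow> \<tau> n > 0"
    and step: "\<And>n. n \<ge> 1 \<Longrightarrow> p n = p (n - 1) + \<tau> n *\<^sub>R (gd - K (u n))"
    and dom: "\<And>n. n \<ge> 1 \<Longrightarrow> u n \<in> D" and "w \<in> D"
    and subgrad: "\<And>n v. n \<ge> 1 \<Longrightarrow> v \<in> D \<Longrightarrow> j (u n) + p n \<bullet> (K v - K (u n)) \<le> j v"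
    and source: "\<And>v. v \<in> D \<Longrightarrow> j w + q \<bullet> (K v - K w) \<le> j v"
    and noise: "norm (gd - K w) \<le> \<delta>" and "n \<ge> 1"
  shows "(step_sum \<tau> n)\<^sup>2 * ((norm (K (u n) - gd))\<^sup>2 - \<delta>\<^sup>2) \<le> (norm (q - p 0))\<^sup>2"
proof -
  define r where "r n = gd - K (u n)" for n
  define e where "e n = p n - q" for n
  define G where "G n = - (p n \<bullet> r n) - j (u n)" for n
  define Gq where "Gq = q \<bullet> (K w - gd) - j w"
  define t where "t = step_sum \<tau>"
  note t_nonneg = step_sum_nonneg[of \<tau>, OF pos, folded t_def]
  have Guler: "2 * t n * (G n - Gq) + (norm (e n))\<^sup>2 + (t n)\<^sup>2 * (norm (r n))\<^sup>2 \<le> (norm (e 0))\<^sup>2" for n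
  proof (induction n)
    case (Suc n)
    define a where "a = \<tau> (Suc n)"
    have a: "a > 0" using pos by (simp add: a_def)
    have pS: "p (Suc n) = p n + a *\<^sub>R r (Suc n)" using step[of "Suc n"] by (simp add: a_def r_def)
    \<comment> \<open>Both inequalities carry powers of \<open>t n\<close>, so they are trivial at
      \<open>n = 0\<close>, where \<open>u 0\<close> is arbitrary and has no subgradient
      property.\<close>
    have decrease: "t n * (G (Suc n) + a * (norm (r (Suc n)))\<^sup>2) \<le> t n * G n
      \<and> (t n)\<^sup>2 * (norm (r (Suc n)))\<^sup>2 \<le> (t n)\<^sup>2 * (norm (r n))\<^sup>2"
    proof (cases "n = 0")
      case True
      then show ?thesis by (simp add: t_def step_sum_def)
    next
      case False
      have 1: "j (u n) + p n \<bullet> (r n - r (Suc n)) \<le> j (u (Suc n))"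
        using subgrad[of n "u (Suc n)"] dom[of "Suc n"] False by (simp add: r_def)
      have 2: "j (u (Suc n)) + p (Suc n) \<bullet> (r (Suc n) - r n) \<le> j (u n)"
        using subgrad[of "Suc n" "u n"] dom[of n] False by (simp add: r_def)
      \<comment> \<open>The extra term \<open>a * (norm (r (Suc n)))\<^sup>2\<close> will absorb the
        cross term from expanding \<open>(t n + a)\<^sup>2\<close>.\<close>
      have G: "G (Suc n) + a * (norm (r (Suc n)))\<^sup>2 \<le> G n"
        using 1 unfolding G_def pS
        by (simp add: power2_norm_eq_inner inner_add_left inner_diff_right)
      \<comment> \<open>Adding 1 and 2 is monotonicity of the subdifferential. With Cauchy-Schwarz
        it makes the residual norms nonincreasing.\<close>
      have "a * (r (Suc n) \<bullet> (r (Suc n) - r n)) \<le> 0"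
        using 1 2 unfolding pS by (simp add: inner_add_left inner_diff_right algebra_simps)
      then have "r (Suc n) \<bullet> (r (Suc n) - r n) \<le> 0"
        using a by (simp add: mult_le_0_iff)
      then have "(norm (r (Suc n)))\<^sup>2 \<le> r (Suc n) \<bullet> r n"
        by (simp add: inner_diff_right power2_norm_eq_inner)
      also have "\<dots> \<le> norm (r (Suc n)) * norm (r n)" by (rule norm_cauchy_schwarz)
      finally have "norm (r (Suc n)) \<le> norm (r n)"
        by (cases "r (Suc n) = 0") (simp_all add: power2_eq_square)
      then show ?thesis using G t_nonneg[of n] by (auto intro!: mult_left_mono power_mono)
    qed
    \<comment> \<open>The source condition at \<open>u (Suc n)\<close> becomes the subgradient
      inequality of the dual functional at \<open>p (Suc n)\<close>, tested at
      \<open>q\<close>.\<close>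
    have "j w + q \<bullet> (gd - r (Suc n) - K w) \<le> j (u (Suc n))"
      using source[of "u (Suc n)"] dom[of "Suc n"] by (simp add: r_def)
    then have "G (Suc n) + r (Suc n) \<bullet> e (Suc n) \<le> Gq"
      by (simp add: G_def Gq_def e_def inner_diff_right inner_commute)
    then have "a * (G (Suc n) + r (Suc n) \<bullet> e (Suc n)) \<le> a * Gq" using a by simp
    moreover have "(norm (e n))\<^sup>2
        = (norm (e (Suc n)))\<^sup>2 - 2 * a * (r (Suc n) \<bullet> e (Suc n)) + a\<^sup>2 * (norm (r (Suc n)))\<^sup>2"
    proof -
      have e: "e n = e (Suc n) - a *\<^sub>R r (Suc n)" by (simp add: e_def pS)
      show ?thesis
        unfolding e power2_norm_eq_inner
        by (simp add: inner_diff_left inner_diff_right inner_commute power2_eq_square algebra_simps)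
    qed
    moreover have "t (Suc n) = t n + a" by (simp add: t_def step_sum_Suc a_def)
    ultimately show ?case using decrease Suc.IH
      by (simp add: power2_eq_square algebra_simps)
  qed (simp add: t_def step_sum_def)
  \<comment> \<open>Conversely, \<open>K w - gd\<close> is a dual subgradient at \<open>q\<close>.
    Its norm is at most the noise level, so \<open>G n\<close> cannot fall far below
    \<open>Gq\<close>.\<close>
  have "j (u n) + p n \<bullet> (K w - gd + r n) \<le> j w"
    using subgrad[OF \<open>n \<ge> 1\<close> \<open>w \<in> D\<close>] by (simp add: r_def)
  then have "e n \<bullet> (K w - gd) \<le> G n - Gq"
    by (simp add: G_def Gq_def e_def inner_add_right inner_diff_left)
  moreover have "- (norm (e n) * \<delta>) \<le> e n \<bullet> (K w - gd)"
  proof -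
    have "- (e n \<bullet> (K w - gd)) \<le> norm (e n) * norm (gd - K w)"
      using norm_cauchy_schwarz[of "e n" "gd - K w"] by (simp add: inner_diff_right)
    also have "\<dots> \<le> norm (e n) * \<delta>" using noise by (simp add: mult_left_mono)
    finally show ?thesis by simp
  qed
  ultimately have "t n * (- (norm (e n) * \<delta>)) \<le> t n * (G n - Gq)"
    using t_nonneg by (intro mult_left_mono) auto
  moreover have "0 \<le> (norm (e n) - t n * \<delta>)\<^sup>2" by simp
  ultimately have "(t n)\<^sup>2 * ((norm (r n))\<^sup>2 - \<delta>\<^sup>2) \<le> (norm (e 0))\<^sup>2"
    using Guler[of n] by (simp add: power2_eq_square algebra_simps)
  then show ?thesis by (simp add: t_def r_def e_def norm_minus_commute)
qed

section \<open>The discrepancy principle\<close>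

text \<open>An index that violates the stopping test has a bounded step sum, so divergence of the
  step sums forces stopping. The bound holds one step earlier, and the last step costs at most the
  supremum.\<close>

lemma morozov_step_sum_bound:
  assumes est: "\<And>n. n \<ge> 1 \<Longrightarrow> (step_sum \<tau> n)\<^sup>2 * ((norm (K (u n) - gd))\<^sup>2 - \<delta>\<^sup>2) \<le> E\<^sup>2"
    and pos: "\<And>n. n \<ge> 1 \<Longrightarrow> \<tau> n > 0"
    and lim: "filterlim (step_sum \<tau>) at_top sequentially"
    and bdd: "bdd_above (\<tau> ` {1..})"
    and "\<delta> > 0" "\<rho> > 1" "E \<ge> 0"
  shows "\<delta> * step_sum \<tau> (morozov_index K \<rho> \<delta> gd u) \<le> E / sqrt (\<rho> - 1) + \<delta> * (SUP k\<in>{1..}. \<tau> k)"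
proof -
  have bound: "\<delta> * step_sum \<tau> n \<le> E / sqrt (\<rho> - 1)"
    if "n \<ge> 1" "\<not> norm (K (u n) - gd) < \<rho> * \<delta>" for n
  proof -
    have "(\<rho> * \<delta>)\<^sup>2 \<le> (norm (K (u n) - gd))\<^sup>2"
      using that \<open>\<delta> > 0\<close> \<open>\<rho> > 1\<close> by (intro power_mono) auto
    \<comment> \<open>Using \<open>\<rho> \<le> \<rho>\<^sup>2\<close> here weakens
      \<open>\<rho>\<^sup>2 - 1\<close> to \<open>\<rho> - 1\<close>.\<close>
    moreover have "\<rho> * \<delta>\<^sup>2 \<le> \<rho>\<^sup>2 * \<delta>\<^sup>2"
      using \<open>\<rho> > 1\<close> by (intro mult_right_mono) (auto simp: power2_eq_square)
    ultimately have "(\<rho> - 1) * \<delta>\<^sup>2 \<le> (norm (K (u n) - gd))\<^sup>2 - \<delta>\<^sup>2"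
      by (simp add: power_mult_distrib algebra_simps)
    then have "(step_sum \<tau> n)\<^sup>2 * ((\<rho> - 1) * \<delta>\<^sup>2) \<le> E\<^sup>2"
      using est[OF that(1)] by (meson mult_left_mono order_trans zero_le_power2)
    then have "(\<delta> * step_sum \<tau> n * sqrt (\<rho> - 1))\<^sup>2 \<le> E\<^sup>2"
      using \<open>\<rho> > 1\<close> by (simp add: power_mult_distrib mult_ac)
    then have "\<delta> * step_sum \<tau> n * sqrt (\<rho> - 1) \<le> E"
      using \<open>E \<ge> 0\<close> by (rule power2_le_imp_le)
    then show ?thesis using \<open>\<rho> > 1\<close> by (simp add: field_simps)
  qed
  define P where "P n \<longleftrightarrow> n \<ge> 1 \<and> norm (K (u n) - gd) < \<rho> * \<delta>" for n
  \<comment> \<open>Without a witness, \<open>LEAST\<close> would be unspecified.\<close>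
  have "\<exists>n. P n"
  proof -
    have "\<forall>\<^sub>F n in sequentially. step_sum \<tau> n > E / sqrt (\<rho> - 1) / \<delta>"
      using lim by (auto simp: filterlim_at_top_dense)
    then obtain N where "\<And>n. n \<ge> N \<Longrightarrow> step_sum \<tau> n > E / sqrt (\<rho> - 1) / \<delta>"
      by (auto simp: eventually_sequentially)
    then obtain n where "n \<ge> 1" "step_sum \<tau> n > E / sqrt (\<rho> - 1) / \<delta>"
      by (meson max.cobounded1 max.cobounded2)
    then have "\<delta> * step_sum \<tau> n > E / sqrt (\<rho> - 1)"
      using \<open>\<delta> > 0\<close> by (metis mult.commute pos_divide_less_eq)
    then show ?thesis using bound[OF \<open>n \<ge> 1\<close>] \<open>n \<ge> 1\<close> by (auto simp: P_def)
  qed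
  moreover define \<Gamma> where "\<Gamma> = morozov_index K \<rho> \<delta> gd u"
  have \<Gamma>: "\<Gamma> = (LEAST n. P n)" by (simp add: \<Gamma>_def morozov_index_def P_def)
  ultimately have "P \<Gamma>" by (auto intro: LeastI_ex)
  then obtain m where m: "\<Gamma> = Suc m" by (cases \<Gamma>) (auto simp: P_def)
  have "\<not> P m" using m \<Gamma> not_less_Least[of m P] by simp
  \<comment> \<open>If stopping occurs at index 1, then \<open>m = 0\<close> lies outside the range
    of \<open>bound\<close>, but the step sum is empty.\<close>
  then have "\<delta> * step_sum \<tau> m \<le> E / sqrt (\<rho> - 1)"
    using bound[of m] \<open>E \<ge> 0\<close> \<open>\<rho> > 1\<close> by (cases m) (auto simp: P_def step_sum_def)
  moreover have "\<delta> * \<tau> (Suc m) \<le> \<delta> * (SUP k\<in>{1..}. \<tau> k)"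
    using \<open>\<delta> > 0\<close> bdd by (intro mult_left_mono cSUP_upper) auto
  ultimately show ?thesis
    unfolding \<Gamma>_def[symmetric] m step_sum_Suc by (simp add: distrib_left)
qed

theorem lemma4p2:
  fixes K :: "'a::{real_inner, complete_space} \<Rightarrow> 'b::{real_inner, complete_space}"
    and J :: "'a \<Rightarrow> ereal"
    and \<tau> :: "nat \<Rightarrow> real"
    and g p\<^sub>0 pdag :: 'b
    and udag :: 'a
    and \<rho> :: real
  assumes "separable_space (euclidean :: 'a topology)"
    and "separable_space (euclidean :: 'b topology)"
    and "bounded_linear K"
    and "convex_fun J" and "lsc_fun J" and "proper_fun J"
    and "\<And>c :: real. weakly_seq_precompact {u. ereal ((norm (K u))\<^sup>2) + J u \<le> ereal c}"
    and "\<exists>u \<in> eff_domain J. K u = g"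
    and "\<And>n. n \<ge> 1 \<Longrightarrow> \<tau> n > 0"
    and "filterlim (step_sum \<tau>) at_top sequentially"
    and "bdd_above (\<tau> ` {1..})"
    and "J_minimizing_solution K J g udag"
    and "adjoint K pdag \<in> subdifferential J udag"
    and "\<rho> > 1"
  shows
    "(\<forall>\<delta> gd u p. \<delta> > 0 \<longrightarrow> norm (gd - g) \<le> \<delta> \<longrightarrow> alm_iterates K J \<tau> p\<^sub>0 gd u p \<longrightarrow>
        \<delta> * step_sum \<tau> (morozov_index K \<rho> \<delta> gd u)
          \<le> norm (pdag - p\<^sub>0) / sqrt (\<rho> - 1) + \<delta> * (SUP k\<in>{1..}. \<tau> k)) \<and>
     (\<forall>(\<delta> :: nat \<Rightarrow> real) (gd :: nat \<Rightarrow> 'b) (u :: nat \<Rightarrow> nat \<Rightarrow> 'a) (p :: nat \<Rightarrow> nat \<Rightarrow> 'b).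
        (\<forall>k. \<delta> k > 0) \<longrightarrow> \<delta> \<longlonglongrightarrow> 0 \<longrightarrow> (\<forall>k. norm (gd k - g) \<le> \<delta> k) \<longrightarrow>
        (\<forall>k. alm_iterates K J \<tau> p\<^sub>0 (gd k) (u k) (p k)) \<longrightarrow>
        (\<exists>C :: real. \<forall>k. \<delta> k * step_sum \<tau> (morozov_index K \<rho> (\<delta> k) (gd k) (u k)) \<le> C))"
proof -
  note K = assms(3)
  have min: "K udag = g" using assms(12) by (simp add: J_minimizing_solution_def is_arg_min_def)
  have dom: "udag \<in> eff_domain J" using assms(13) by (simp add: subdifferential_def)
  have source: "real_of_ereal (J udag) + pdag \<bullet> (K v - K udag) \<le> real_of_ereal (J v)"
    if v: "v \<in> eff_domain J" for v
  proof -
    have "J udag + ereal (adjoint K pdag \<bullet> (v - udag)) \<le> J v"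
      using assms(13) by (simp add: subdifferential_def)
    then have "J udag + ereal (pdag \<bullet> (K v - K udag)) \<le> J v"
      by (simp add: adjoint_inner[OF K] linear_diff[OF bounded_linear.linear[OF K]])
    then show ?thesis
      by (subst (asm) (1 2) proper_fun_eq_ereal[OF assms(6)]) (auto simp: dom v)
  qed
  have main: "\<delta> * step_sum \<tau> (morozov_index K \<rho> \<delta> gd u)
      \<le> norm (pdag - p\<^sub>0) / sqrt (\<rho> - 1) + \<delta> * (SUP k\<in>{1..}. \<tau> k)"
    if "\<delta> > 0" "norm (gd - g) \<le> \<delta>" and alm: "alm_iterates K J \<tau> p\<^sub>0 gd u p" for \<delta> gd u p
  proof (rule morozov_step_sum_bound)
    fix n :: nat assume "n \<ge> 1"
    have p0: "p 0 = p\<^sub>0"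
      and step: "p n = p (n - 1) + \<tau> n *\<^sub>R (gd - K (u n))"
      and argmin: "is_arg_min
          (\<lambda>v. ereal (\<tau> n / 2 * (norm (K v - gd))\<^sup>2) + J v - ereal (p (n - 1) \<bullet> (K v - gd)))
          (\<lambda>v. True) (u n)" if "n \<ge> 1" for n
      using alm that by (auto simp: alm_iterates_def)
    note opt = alm_step_optimality[OF bounded_linear.linear[OF K] assms(4,6) argmin]
    show "(step_sum \<tau> n)\<^sup>2 * ((norm (K (u n) - gd))\<^sup>2 - \<delta>\<^sup>2) \<le> (norm (pdag - p\<^sub>0))\<^sup>2"
      using dual_proximal_estimate[of \<tau> p gd K u "eff_domain J" udag "\<lambda>v. real_of_ereal (J v)" pdag \<delta> n]
        assms(9) step opt dom source \<open>norm (gd - g) \<le> \<delta>\<close> min \<open>n \<ge> 1\<close> p0 by auto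
  qed (use that assms(9-11,14) in auto)
  moreover have "\<exists>C. \<forall>k. \<delta> k * step_sum \<tau> (morozov_index K \<rho> (\<delta> k) (gd k) (u k)) \<le> C"
    if "\<forall>k. \<delta> k > 0" and lim: "\<delta> \<longlonglongrightarrow> 0" and "\<forall>k. norm (gd k - g) \<le> \<delta> k"
      "\<forall>k. alm_iterates K J \<tau> p\<^sub>0 (gd k) (u k) (p k)"
    for \<delta> :: "nat \<Rightarrow> real" and gd :: "nat \<Rightarrow> 'b" and u :: "nat \<Rightarrow> nat \<Rightarrow> 'a" and p :: "nat \<Rightarrow> nat \<Rightarrow> 'b"
  proof -
    obtain M where M: "\<And>k. norm (\<delta> k) \<le> M"
      using convergent_imp_Bseq[OF convergentI[OF lim]] by (auto simp: Bseq_def)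
    \<comment> \<open>Positivity of the supremum allows \<open>\<delta> k\<close> to be replaced by
      its uniform bound \<open>M\<close>.\<close>
    have "0 < \<tau> 1" using assms(9) by simp
    also have "\<dots> \<le> (SUP k\<in>{1..}. \<tau> k)" using assms(11) by (intro cSUP_upper) auto
    finally have "\<delta> k * (SUP k\<in>{1..}. \<tau> k) \<le> M * (SUP k\<in>{1..}. \<tau> k)" for k
      using M[of k] by (intro mult_right_mono) auto
    then have "\<delta> k * step_sum \<tau> (morozov_index K \<rho> (\<delta> k) (gd k) (u k))
        \<le> norm (pdag - p\<^sub>0) / sqrt (\<rho> - 1) + M * (SUP k\<in>{1..}. \<tau> k)" for k
      using main[of "\<delta> k" "gd k" "u k" "p k"] that by (meson add_left_mono order_trans)
    then show ?thesis by blast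
  qed
  ultimately show ?thesis by blast
qed

end
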